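(* Let $Z$ be a $d$-dimensional continuous Gaussian process with law $\nu$ on $\Omega$ and Cameron–Martin space $\mathcal H_\nu$, admitting a level-2 rough path lift $\boldsymbol Z$ with $\boldsymbol Z\in\mathcal D$ almost surely, and let $\boldsymbol\nu$ be the law of $\boldsymbol Z$ on the rough path space $\mathcal D$. Suppose that there exists $\tilde\Omega\subseteq\Omega$ with $\nu(\tilde\Omega)=1$ such that: (i) there exists a Borel-measurable lift map $\tilde\Psi:\Omega\to\mathcal D$ with $\pi_1\tilde\Psi(x)=x$ for $x\in\tilde\Omega$, where $\pi_1$ is the projection onto the first component, such that $\tilde\Psi(Z)=\boldsymbol Z$ almost surely; (ii) there exists a continuous shift map $\mathcal H_\nu\times\mathcal D\to\mathcal D$, $(h,\boldsymbol x)\mapsto\tilde T_h\boldsymbol x$, such that $\tilde T_h\tilde\Psi(x)=\tilde\Psi(x+h)$ for all $x\in\tilde\Omega$, $h\in\mathcal H_\nu$. Then $\boldsymbol\nu\in\mathcal T_2(\mathcal D,\tilde C_{\mathcal H_\nu},1)$.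
   Context: $\Omega=C_0([0,1],\mathbb R^d)$ with the uniform topology. $\mathcal D$ is a level-2 rough path space of $p$-variation type ($p<3$) or $\beta$-Hölder type ($\beta>1/3$): continuous paths $\boldsymbol x$ started at the identity with values in a step-2 Carnot group $\mathbb G\cong\mathbb R^{d}\oplus\mathbb R^{d_2}$ with finite $p$-variation (resp. $\beta$-Hölder) norm for the Carnot–Carathéodory metric, e.g. $\mathcal D=C_0^{p\text{-var}}([0,1],\mathbb G)$, with the corresponding rough path topology; $\pi_1$ denotes the projection of a path to its $\mathbb R^d$-component. The cost $\tilde C_{\mathcal H_\nu}:\mathcal D\times\mathcal D\to[0,\infty]$ is $\tilde C_{\mathcal H_\nu}(\boldsymbol X,\boldsymbol Y)=\|h\|_{\mathcal H_\nu}$ if $\boldsymbol Y=\tilde T_h\boldsymbol X$ for some $h\in\mathcal H_\nu$, and $+\infty$ otherwise. $\Pi(\mu,\nu)$ is the set of couplings; $H(\nu\|\mu)=\int\log\frac{d\nu}{d\mu}d\nu$ if $\nu\ll\mu$, $+\infty$ otherwise. $\mu\in\mathcal T_p(E,c,\alpha)$ means $\big(\inf_{\lambda\in\Pi(\mu,\nu)}\int c^p d\lambda\big)^{1/p}\le\sqrt{\tfrac2\alpha H(\nu\|\mu)}$ for all Borel probability measures $\nu$ on $E$. Known fact that may be used: with $\tilde c_{\mathcal H_\nu}(x,y)=\|x-y\|_{\mathcal H_\nu}$ if $x-y\in\mathcal H_\nu$ and $+\infty$ otherwise, the Gaussian law satisfies $\nu\in\mathcal T_2(\Omega,\tilde c_{\mathcal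 H_\nu},1)$. *)

theory Defs
  imports "HOL-Probability.Probability"
begin

section \<open>Extended-real conventions, topologies and Borel sets\<close>

definition epowr :: "ennreal \<Rightarrow> real \<Rightarrow> ennreal" where
  "epowr x p = (if x = top then top else ennreal (enn2real x powr p))"

text \<open>The topology of a distance on \<open>S\<close>. The distance takes values in \<open>ennreal\<close> because the
  distances below are suprema or infima; if it is a real-valued metric this is the library's
  metric topology (lemma \<open>edist_topology_eq_mtopology\<close>).\<close>

definition edist_topology :: "'x set \<Rightarrow> ('x \<Rightarrow> 'x \<Rightarrow> ennreal) \<Rightarrow> 'x topology" where
  "edist_topology S d =
     topology (\<lambda>U. U \<subseteq> S \<and> (\<forall>x\<in>U. \<exists>r>0. \<forall>y\<in>S. d x y < r \<longrightarrow> y \<in> U))"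

lemma openin_edist_topology:
  "openin (edist_topology S d) U \<longleftrightarrow> U \<subseteq> S \<and> (\<forall>x\<in>U. \<exists>r>0. \<forall>y\<in>S. d x y < r \<longrightarrow> y \<in> U)"
proof -
  let ?P = "\<lambda>U. U \<subseteq> S \<and> (\<forall>x\<in>U. \<exists>r>0. \<forall>y\<in>S. d x y < r \<longrightarrow> y \<in> U)"
  have inter: "?P (U \<inter> V)" if U: "?P U" and V: "?P V" for U V
  proof (intro conjI ballI)
    fix x assume x: "x \<in> U \<inter> V"
    from U x obtain r where r: "r > 0" "\<forall>y\<in>S. d x y < r \<longrightarrow> y \<in> U" by blast
    from V x obtain s where s: "s > 0" "\<forall>y\<in>S. d x y < s \<longrightarrow> y \<in> V" by blast
    have "min r s > 0" "\<forall>y\<in>S. d x y < min r s \<longrightarrow> y \<in> U \<inter> V" using r s by auto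
    then show "\<exists>r>0. \<forall>y\<in>S. d x y < r \<longrightarrow> y \<in> U \<inter> V" by blast
  qed (use U in blast)
  have union: "?P (\<Union>K)" if K: "\<forall>U\<in>K. ?P U" for K
  proof (intro conjI ballI)
    fix x assume "x \<in> \<Union>K"
    then obtain U where U: "U \<in> K" "x \<in> U" by blast
    with K obtain r where "r > 0" "\<forall>y\<in>S. d x y < r \<longrightarrow> y \<in> U" by blast
    with U show "\<exists>r>0. \<forall>y\<in>S. d x y < r \<longrightarrow> y \<in> \<Union>K" by blast
  qed (use K in blast)
  have "istopology ?P"
    unfolding istopology_def
  proof (rule conjI)
    show "\<forall>U V. ?P U \<longrightarrow> ?P V \<longrightarrow> ?P (U \<inter> V)" by (intro allI impI) (rule inter)
    show "\<forall>K. (\<forall>U\<in>K. ?P U) \<longrightarrow> ?P (\<Union>K)" by (intro allI impI) (rule union)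
  qed
  then show ?thesis
    unfolding edist_topology_def by (rule fun_cong[OF topology_inverse'])
qed

lemma topspace_edist_topology [simp]: "topspace (edist_topology S d) = S"
proof -
  have "openin (edist_topology S d) S"
    unfolding openin_edist_topology by (auto intro: exI[of _ 1])
  then show ?thesis
    by (metis openin_edist_topology openin_subset openin_topspace subset_antisym)
qed

lemma edist_topology_eq_mtopology:
  assumes "Metric_space S d"
  shows "edist_topology S (\<lambda>x y. ennreal (d x y)) = Metric_space.mtopology S d"
proof -
  interpret Metric_space S d by fact
  have "(\<exists>r>0. \<forall>y\<in>S. ennreal (d x y) < r \<longrightarrow> y \<in> U) \<longleftrightarrow> (\<exists>r>0. mball x r \<subseteq> U)"
    if "U \<subseteq> S" "x \<in> U" for U x
  proof
    assume "\<exists>r>0. \<forall>y\<in>S. ennreal (d x y) < r \<longrightarrow> y \<in> U"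
    then obtain r where r: "r > 0" "\<forall>y\<in>S. ennreal (d x y) < r \<longrightarrow> y \<in> U" by blast
    obtain e where e: "e > 0" "ennreal e \<le> r"
    proof (cases "r = top")
      case True then show ?thesis using that[of 1] by simp
    next
      case False
      then show ?thesis using that[of "enn2real r"] r(1)
        by (simp add: enn2real_positive_iff top.not_eq_extremum)
    qed
    have "y \<in> U" if "y \<in> mball x e" for y
    proof -
      have "ennreal (d x y) < ennreal e" using that e(1) by (simp add: ennreal_less_iff)
      then show ?thesis using that e(2) r(2) by (meson in_mball less_le_trans)
    qed
    with e(1) show "\<exists>r>0. mball x r \<subseteq> U" by blast
  next
    assume "\<exists>r>0. mball x r \<subseteq> U"
    then obtain r where r: "r > 0" "mball x r \<subseteq> U" by blast
    have "y \<in> U" if y: "y \<in> S" "ennreal (d x y) < ennreal r" for y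
    proof -
      have "d x y < r" using y(2) by (simp add: ennreal_less_iff)
      moreover have "x \<in> S" using \<open>U \<subseteq> S\<close> \<open>x \<in> U\<close> by (rule subsetD)
      ultimately have "y \<in> mball x r" using y(1) by (simp only: in_mball)
      with r(2) show ?thesis by (rule subsetD)
    qed
    moreover have "ennreal r > 0" using r(1) by simp
    ultimately show "\<exists>r>0. \<forall>y\<in>S. ennreal (d x y) < r \<longrightarrow> y \<in> U" by blast
  qed
  then have "openin (edist_topology S (\<lambda>x y. ennreal (d x y))) U \<longleftrightarrow> openin mtopology U" for U
    unfolding openin_edist_topology openin_mtopology by (meson subsetD)
  then show ?thesis by (simp add: topology_eq)
qed

definition topo_borel :: "'x topology \<Rightarrow> 'x measure" where
  "topo_borel T = sigma (topspace T) {U. openin T U}"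


section \<open>Transportation-cost inequalities\<close>

text \<open>\<open>KL_divergence (exp 1) \<mu> \<nu>\<close> is the Bochner integral of \<open>ln (d\<nu>/d\<mu>)\<close> with respect to \<open>\<nu>\<close>. The
  negative part of \<open>ln (d\<nu>/d\<mu>)\<close> is always \<open>\<nu>\<close>-integrable, so for \<open>\<nu> \<lless> \<mu>\<close> the integral fails to
  exist only when its value is \<open>+\<infinity>\<close>.\<close>

definition relative_entropy :: "'x measure \<Rightarrow> 'x measure \<Rightarrow> ennreal" where
  "relative_entropy \<nu> \<mu> =
     (if absolutely_continuous \<mu> \<nu> \<and> integrable \<nu> (entropy_density (exp 1) \<mu> \<nu>)
      then ennreal (KL_divergence (exp 1) \<mu> \<nu>) else \<infinity>)"

definition couplings :: "'x measure \<Rightarrow> 'y measure \<Rightarrow> ('x \<times> 'y) measure set" where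
  "couplings \<mu> \<nu> =
     {\<pi>. sets \<pi> = sets (\<mu> \<Otimes>\<^sub>M \<nu>) \<and> distr \<pi> \<mu> fst = \<mu> \<and> distr \<pi> \<nu> snd = \<nu>}"

text \<open>The integral of a measurable function, and the upper integral otherwise. A cost defined through
  a shift map need not be jointly measurable, and the library's \<open>nn_integral\<close> would then silently be
  a lower integral, which would weaken the transportation-cost inequality.\<close>

definition upper_nn_integral :: "'x measure \<Rightarrow> ('x \<Rightarrow> ennreal) \<Rightarrow> ennreal" where
  "upper_nn_integral M f =
     Inf {\<integral>\<^sup>+ x. g x \<partial>M | g. g \<in> borel_measurable M \<and> (\<forall>x\<in>space M. f x \<le> g x)}"

lemma upper_nn_integral_eq_nn_integral:
  assumes "f \<in> borel_measurable M"
  shows "upper_nn_integral M f = (\<integral>\<^sup>+ x. f x \<partial>M)"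
  unfolding upper_nn_integral_def using assms
  by (intro antisym Inf_lower Inf_greatest) (auto intro!: nn_integral_mono)

text \<open>\<open>transport_ineq p E c \<alpha> \<mu>\<close> is \<open>\<mu> \<in> T\<^sub>p(E, c, \<alpha>)\<close>.\<close>

definition transport_ineq ::
  "real \<Rightarrow> 'x topology \<Rightarrow> ('x \<Rightarrow> 'x \<Rightarrow> ennreal) \<Rightarrow> real \<Rightarrow> 'x measure \<Rightarrow> bool" where
  "transport_ineq p E c \<alpha> \<mu> \<longleftrightarrow>
     prob_space \<mu> \<and> sets \<mu> = sets (topo_borel E) \<and>
     (\<forall>\<nu>. prob_space \<nu> \<and> sets \<nu> = sets (topo_borel E) \<longrightarrow>
        epowr (INF \<pi>\<in>couplings \<mu> \<nu>. upper_nn_integral \<pi> (\<lambda>(x, y). epowr (c x y) p)) (1 / p)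
          \<le> epowr (ennreal (2 / \<alpha>) * relative_entropy \<nu> \<mu>) (1 / 2))"


section \<open>Path space, Gaussian processes and Cameron--Martin spaces\<close>

text \<open>A path on \<open>[0,1]\<close> is a function on \<open>\<real>\<close> that vanishes outside \<open>[0,1]\<close>, so that
  equality of functions is equality of paths and pointwise addition stays inside the space.\<close>

definition path_space :: "(real \<Rightarrow> 'a::euclidean_space) set" where
  "path_space = {x. continuous_on {0..1} x \<and> x 0 = 0 \<and> (\<forall>t. t \<notin> {0..1} \<longrightarrow> x t = 0)}"

definition path_topology :: "(real \<Rightarrow> 'a::euclidean_space) topology" where
  "path_topology = edist_topology path_space (\<lambda>x y. SUP t\<in>{0..1}. ennreal (norm (x t - y t)))"

definition gaussian_real :: "real measure \<Rightarrow> bool" where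
  "gaussian_real N \<longleftrightarrow>
     (\<exists>m. N = return borel m) \<or> (\<exists>m \<sigma>. \<sigma> > 0 \<and> N = density lborel (\<lambda>x. ennreal (normal_density m \<sigma> x)))"

definition gaussian_process :: "'w measure \<Rightarrow> ('w \<Rightarrow> real \<Rightarrow> 'a::euclidean_space) \<Rightarrow> bool" where
  "gaussian_process M Z \<longleftrightarrow>
     (\<forall>n (t :: nat \<Rightarrow> real) (a :: nat \<Rightarrow> 'a). (\<forall>i<n. t i \<in> {0..1}) \<longrightarrow>
        gaussian_real (distr M borel (\<lambda>w. \<Sum>i<n. a i \<bullet> Z w (t i))))"

text \<open>Centred coordinate of the canonical process under a law \<open>\<mu>\<close> on path space; the process is not
  required to be centred.\<close>

definition centred :: "(real \<Rightarrow> 'a::euclidean_space) measure \<Rightarrow> real \<Rightarrow> (real \<Rightarrow> 'a) \<Rightarrow> 'a" where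
  "centred \<mu> t x = x t - (\<integral>y. y t \<partial>\<mu>)"

text \<open>The first chaos: closure in \<open>L\<^sup>2(\<mu>)\<close> of the linear span of the centred coordinates.\<close>

definition first_chaos ::
  "(real \<Rightarrow> 'a::euclidean_space) measure \<Rightarrow> ((real \<Rightarrow> 'a) \<Rightarrow> real) set" where
  "first_chaos \<mu> =
     {\<xi>. \<xi> \<in> borel_measurable \<mu> \<and> integrable \<mu> (\<lambda>x. (\<xi> x)\<^sup>2) \<and>
        (\<forall>\<epsilon>>0. \<exists>n (t :: nat \<Rightarrow> real) (a :: nat \<Rightarrow> 'a). (\<forall>i<n. t i \<in> {0..1}) \<and>
           (\<integral>x. (\<xi> x - (\<Sum>i<n. a i \<bullet> centred \<mu> (t i) x))\<^sup>2 \<partial>\<mu>) < \<epsilon>)}"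

text \<open>\<open>h\<^sub>t = E[\<xi> (Z\<^sub>t - E Z\<^sub>t)]\<close>. The representer \<open>\<xi>\<close> in the first chaos is unique almost everywhere,
  and the norm of \<open>h\<close> is the \<open>L\<^sup>2\<close>-norm of \<open>\<xi>\<close>.\<close>

definition cm_represents ::
  "(real \<Rightarrow> 'a::euclidean_space) measure \<Rightarrow> ((real \<Rightarrow> 'a) \<Rightarrow> real) \<Rightarrow> (real \<Rightarrow> 'a) \<Rightarrow> bool" where
  "cm_represents \<mu> \<xi> h \<longleftrightarrow>
     \<xi> \<in> first_chaos \<mu> \<and> (\<forall>t\<in>{0..1}. h t = (\<integral>x. \<xi> x *\<^sub>R centred \<mu> t x \<partial>\<mu>))"

definition cm_space :: "(real \<Rightarrow> 'a::euclidean_space) measure \<Rightarrow> (real \<Rightarrow> 'a) set" where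
  "cm_space \<mu> = {h \<in> path_space. \<exists>\<xi>. cm_represents \<mu> \<xi> h}"

definition cm_norm :: "(real \<Rightarrow> 'a::euclidean_space) measure \<Rightarrow> (real \<Rightarrow> 'a) \<Rightarrow> real" where
  "cm_norm \<mu> h = (THE r. \<exists>\<xi>. cm_represents \<mu> \<xi> h \<and> r = sqrt (\<integral>x. (\<xi> x)\<^sup>2 \<partial>\<mu>))"

definition cm_topology :: "(real \<Rightarrow> 'a::euclidean_space) measure \<Rightarrow> (real \<Rightarrow> 'a) topology" where
  "cm_topology \<mu> = edist_topology (cm_space \<mu>) (\<lambda>g h. ennreal (cm_norm \<mu> (\<lambda>t. g t - h t)))"

definition cm_cost ::
  "(real \<Rightarrow> 'a::euclidean_space) measure \<Rightarrow> (real \<Rightarrow> 'a) \<Rightarrow> (real \<Rightarrow> 'a) \<Rightarrow> ennreal" where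
  "cm_cost \<mu> x y =
     (if (\<lambda>t. x t - y t) \<in> cm_space \<mu> then ennreal (cm_norm \<mu> (\<lambda>t. x t - y t)) else \<infinity>)"


section \<open>Step-2 Carnot groups and rough path spaces\<close>

text \<open>In exponential coordinates a step-2 Carnot group is \<open>V\<^sub>1 \<oplus> V\<^sub>2\<close>, with \<open>V\<^sub>1\<close> the Euclidean space
  \<open>'a\<close>, a bilinear alternating bracket \<open>V\<^sub>1 \<times> V\<^sub>1 \<rightarrow> V\<^sub>2\<close> whose values span \<open>V\<^sub>2\<close>, and the
  Baker--Campbell--Hausdorff product. The second layer is a subspace of the ambient type \<open>'b\<close> so that
  \<open>d\<^sub>2 = 0\<close> (which is forced when \<open>d = 1\<close>) is not excluded.\<close>

definition carnot_bracket :: "('a::euclidean_space \<Rightarrow> 'a \<Rightarrow> 'b::euclidean_space) \<Rightarrow> bool" where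
  "carnot_bracket br \<longleftrightarrow> bilinear br \<and> (\<forall>x. br x x = 0)"

definition carnot_carrier ::
  "('a::euclidean_space \<Rightarrow> 'a \<Rightarrow> 'b::euclidean_space) \<Rightarrow> ('a \<times> 'b) set" where
  "carnot_carrier br = UNIV \<times> span {br x y | x y. True}"

definition carnot_mult ::
  "('a::euclidean_space \<Rightarrow> 'a \<Rightarrow> 'b::euclidean_space) \<Rightarrow> 'a \<times> 'b \<Rightarrow> 'a \<times> 'b \<Rightarrow> 'a \<times> 'b" where
  "carnot_mult br g h = (fst g + fst h, snd g + snd h + (1 / 2) *\<^sub>R br (fst g) (fst h))"

text \<open>The identity is \<open>0\<close> and the inverse of \<open>g\<close> is \<open>- g\<close>.\<close>

lemma
  assumes "carnot_bracket br"
  shows carnot_mult_assoc: "carnot_mult br (carnot_mult br g h) k = carnot_mult br g (carnot_mult br h k)"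
    and carnot_mult_zero: "carnot_mult br 0 g = g" "carnot_mult br g 0 = g"
    and carnot_mult_inverse: "carnot_mult br (- g) g = 0" "carnot_mult br g (- g) = 0"
proof -
  have b: "bilinear br" "\<And>x. br x x = 0" using assms by (auto simp: carnot_bracket_def)
  show "carnot_mult br (carnot_mult br g h) k = carnot_mult br g (carnot_mult br h k)"
    unfolding carnot_mult_def
    by (simp add: bilinear_ladd[OF b(1)] bilinear_radd[OF b(1)] algebra_simps)
  show "carnot_mult br 0 g = g" "carnot_mult br g 0 = g"
    "carnot_mult br (- g) g = 0" "carnot_mult br g (- g) = 0"
    by (simp_all add: carnot_mult_def bilinear_lzero[OF b(1)] bilinear_rzero[OF b(1)]
        bilinear_lneg[OF b(1)] bilinear_rneg[OF b(1)] b(2) zero_prod_def)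
qed

text \<open>Horizontal curves: absolutely continuous solutions of \<open>\<gamma>' = \<Sum>\<^sub>i u\<^sub>i X\<^sub>i(\<gamma>)\<close> for the left-invariant
  fields \<open>X\<^sub>i(x, a) = (e\<^sub>i, [x, e\<^sub>i] / 2)\<close> spanning the first layer, in integrated form.\<close>

definition horizontal_curve ::
  "('a::euclidean_space \<Rightarrow> 'a \<Rightarrow> 'b::euclidean_space) \<Rightarrow> (real \<Rightarrow> 'a) \<Rightarrow> (real \<Rightarrow> 'a \<times> 'b) \<Rightarrow> bool" where
  "horizontal_curve br u \<gamma> \<longleftrightarrow>
     u absolutely_integrable_on {0..1} \<and>
     (\<forall>t\<in>{0..1}. fst (\<gamma> t) = fst (\<gamma> 0) + integral {0..t} u \<and>
        snd (\<gamma> t) = snd (\<gamma> 0) + integral {0..t} (\<lambda>s. (1 / 2) *\<^sub>R br (fst (\<gamma> s)) (u s)))"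

definition cc_dist ::
  "('a::euclidean_space \<Rightarrow> 'a \<Rightarrow> 'b::euclidean_space) \<Rightarrow> 'a \<times> 'b \<Rightarrow> 'a \<times> 'b \<Rightarrow> ennreal" where
  "cc_dist br g h =
     Inf {ennreal (integral {0..1} (\<lambda>t. norm (u t))) | u \<gamma>.
       horizontal_curve br u \<gamma> \<and> \<gamma> 0 = g \<and> \<gamma> 1 = h}"

definition path_increment ::
  "('a::euclidean_space \<Rightarrow> 'a \<Rightarrow> 'b::euclidean_space) \<Rightarrow> (real \<Rightarrow> 'a \<times> 'b) \<Rightarrow> real \<Rightarrow> real \<Rightarrow> 'a \<times> 'b" where
  "path_increment br X s t = carnot_mult br (- X s) (X t)"

datatype rough_type = PVar real | Hoelder real

fun level2_type :: "rough_type \<Rightarrow> bool" where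
  "level2_type (PVar p) \<longleftrightarrow> 1 \<le> p \<and> p < 3"
| "level2_type (Hoelder \<beta>) \<longleftrightarrow> 1 / 3 < \<beta>"

definition dissections :: "(nat \<times> (nat \<Rightarrow> real)) set" where
  "dissections = {(n, t). t 0 = 0 \<and> t n = 1 \<and> (\<forall>i<n. t i \<le> t (Suc i))}"

fun variation :: "rough_type \<Rightarrow> (real \<Rightarrow> real \<Rightarrow> ennreal) \<Rightarrow> ennreal" where
  "variation (PVar p) F =
     epowr (SUP (n, t)\<in>dissections. \<Sum>i<n. epowr (F (t i) (t (Suc i))) p) (1 / p)"
| "variation (Hoelder \<beta>) F =
     (SUP (s, t)\<in>{(s, t). 0 \<le> s \<and> s < t \<and> t \<le> 1}. F s t / ennreal ((t - s) powr \<beta>))"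

text \<open>Continuity is with respect to the Euclidean topology of \<open>V\<^sub>1 \<oplus> V\<^sub>2\<close>, which is the topology of the
  Carnot--Caratheodory metric.\<close>

definition rough_paths ::
  "('a::euclidean_space \<Rightarrow> 'a \<Rightarrow> 'b::euclidean_space) \<Rightarrow> rough_type \<Rightarrow> (real \<Rightarrow> 'a \<times> 'b) set" where
  "rough_paths br ty =
     {X. continuous_on {0..1} X \<and> X 0 = 0 \<and> (\<forall>t\<in>{0..1}. X t \<in> carnot_carrier br) \<and>
         (\<forall>t. t \<notin> {0..1} \<longrightarrow> X t = 0) \<and>
         variation ty (\<lambda>s t. cc_dist br (X s) (X t)) < \<infinity>}"

definition rough_dist ::
  "('a::euclidean_space \<Rightarrow> 'a \<Rightarrow> 'b::euclidean_space) \<Rightarrow> rough_type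
    \<Rightarrow> (real \<Rightarrow> 'a \<times> 'b) \<Rightarrow> (real \<Rightarrow> 'a \<times> 'b) \<Rightarrow> ennreal" where
  "rough_dist br ty X Y =
     variation ty (\<lambda>s t. cc_dist br (path_increment br X s t) (path_increment br Y s t))"

definition rough_topology ::
  "('a::euclidean_space \<Rightarrow> 'a \<Rightarrow> 'b::euclidean_space) \<Rightarrow> rough_type \<Rightarrow> (real \<Rightarrow> 'a \<times> 'b) topology" where
  "rough_topology br ty = edist_topology (rough_paths br ty) (rough_dist br ty)"

definition proj1 :: "(real \<Rightarrow> 'a \<times> 'b) \<Rightarrow> real \<Rightarrow> 'a" where
  "proj1 X = (\<lambda>t. fst (X t))"

text \<open>If several \<open>h\<close> satisfy \<open>Y = T h X\<close> the infimum of their norms is taken.\<close>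

definition shift_cost ::
  "(real \<Rightarrow> 'a::euclidean_space) measure
    \<Rightarrow> ((real \<Rightarrow> 'a) \<Rightarrow> (real \<Rightarrow> 'a \<times> 'b) \<Rightarrow> (real \<Rightarrow> 'a \<times> 'b))
    \<Rightarrow> (real \<Rightarrow> 'a \<times> 'b) \<Rightarrow> (real \<Rightarrow> 'a \<times> 'b) \<Rightarrow> ennreal" where
  "shift_cost \<mu> T X Y = Inf {ennreal (cm_norm \<mu> h) | h. h \<in> cm_space \<mu> \<and> Y = T h X}"

end

(* Given a law N on rough paths with density f with respect to the law of the lift, f o Psi is the
   density of a law eta on path space with the same relative entropy, and Psi pushes eta forward to N.
   Pushing couplings forward under Psi x Psi does not increase the cost, because Psi intertwines
   translations by Cameron-Martin paths with the shifts T_h. Since the cost need not be measurable,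
   its measurable majorants are transported too: on the Borel set Psi(Omega'), proj1 is a continuous
   inverse of Psi. *)

theory Submission
  imports Defs
begin

section \<open>Borel sets of a topology\<close>

lemma space_topo_borel [simp]: "space (topo_borel T) = topspace T"
  unfolding topo_borel_def by (intro space_measure_of) (auto dest: openin_subset)

lemma openin_topo_borel: "openin T U \<Longrightarrow> U \<in> sets (topo_borel T)"
  unfolding topo_borel_def by (subst sets_measure_of) (auto dest: openin_subset)

lemma measurable_topo_borelI:
  assumes "f \<in> space M \<rightarrow> topspace T"
    and "\<And>U. openin T U \<Longrightarrow> f -` U \<inter> space M \<in> sets M"
  shows "f \<in> measurable M (topo_borel T)"
  unfolding topo_borel_def using assms
  by (intro measurable_measure_of) (auto dest: openin_subset)

section \<open>Push-forward of transportation-cost inequalities\<close>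

text \<open>Here \<open>f\<close> need not be measurable: it may leave \<open>space N\<close> on a null set.\<close>

lemma distr_cong_AE_vimage:
  assumes f: "\<And>A. A \<in> sets N \<Longrightarrow> f -` A \<inter> space M \<in> sets M"
    and g: "g \<in> measurable M N" and AE: "AE x in M. g x = f x"
  shows "distr M N f = distr M N g"
  unfolding distr_def
proof (rule measure_of_eq[OF sets.space_closed])
  fix A assume "A \<in> sigma_sets (space N) (sets N)"
  then have A: "A \<in> sets N" by (simp add: sets.sigma_sets_eq)
  \<comment> \<open>\<open>distr\<close> sees only the measures of preimages. The two preimages
    differ by a null set, and that of \<open>f\<close> is measurable by the first
    assumption.\<close>
  show "emeasure M (f -` A \<inter> space M) = emeasure M (g -` A \<inter> space M)"
    using AE by (intro emeasure_eq_AE f[OF A] measurable_sets[OF g A]) auto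
qed

section \<open>Entropy and transport cost under push-forward\<close>

lemma epowr_mono: "x \<le> y \<Longrightarrow> 0 \<le> p \<Longrightarrow> epowr x p \<le> epowr y p"
  unfolding epowr_def
  by (auto simp: top_unique enn2real_mono top.not_eq_extremum intro!: ennreal_leI powr_mono2)

text \<open>The density of \<open>N\<close> with respect to the image law, composed with
  \<open>\<Psi>\<close>, is the density of \<open>\<eta>\<close> with respect to
  \<open>\<nu>\<close>. Hence the two log-densities correspond under \<open>\<Psi>\<close>, and a
  change of variables identifies their integrals.\<close>

lemma relative_entropy_density_comp:
  assumes \<nu>: "prob_space \<nu>" and N: "prob_space N"
    and \<Psi> [measurable]: "\<Psi> \<in> measurable \<nu> B"
    and sets_N: "sets N = sets B"
    and ac: "absolutely_continuous (distr \<nu> B \<Psi>) N"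
    and \<eta>: "\<eta> = density \<nu> (\<lambda>x. RN_deriv (distr \<nu> B \<Psi>) N (\<Psi> x))"
  shows "distr \<eta> B \<Psi> = N" and "relative_entropy \<eta> \<nu> = relative_entropy N (distr \<nu> B \<Psi>)"
proof -
  interpret \<nu>: prob_space \<nu> by fact
  interpret N: prob_space N by fact
  let ?B\<nu> = "distr \<nu> B \<Psi>"
  interpret B\<nu>: prob_space ?B\<nu> by (rule \<nu>.prob_space_distr) fact
  let ?f = "RN_deriv ?B\<nu> N"
  have f [measurable]: "?f \<in> borel_measurable B"
    using borel_measurable_RN_deriv[of ?B\<nu> N] by simp
  have "density ?B\<nu> ?f = N"
    using B\<nu>.density_RN_deriv[OF ac] sets_N by simp
  then show distr: "distr \<eta> B \<Psi> = N"
    unfolding \<eta> by (simp add: density_distr)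
  have sets_\<eta> [measurable_cong]: "sets \<eta> = sets \<nu>" unfolding \<eta> by simp
  have ac\<eta>: "absolutely_continuous \<nu> \<eta>"
    unfolding \<eta> by (rule absolutely_continuousI_density) measurable
  \<comment> \<open>Uniqueness of densities holds up to \<open>\<nu>\<close>-null sets; absolute
    continuity then gives it \<open>\<eta>\<close>-almost everywhere, and \<open>\<eta>\<close> is
    the measure used in the entropy integral.\<close>
  have "AE x in \<nu>. ?f (\<Psi> x) = RN_deriv \<nu> \<eta> x"
    unfolding \<eta> by (rule \<nu>.RN_deriv_unique) simp_all
  then have "AE x in \<eta>. ?f (\<Psi> x) = RN_deriv \<nu> \<eta> x"
    by (rule absolutely_continuous_AE[OF sets_\<eta> ac\<eta>])
  then have AE: "AE x in \<eta>. entropy_density (exp 1) \<nu> \<eta> x = entropy_density (exp 1) ?B\<nu> N (\<Psi> x)"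
    by eventually_elim (simp add: entropy_density_def)
  have [measurable]: "entropy_density (exp 1) ?B\<nu> N \<in> borel_measurable B"
    unfolding entropy_density_def by measurable
  have [measurable]: "entropy_density (exp 1) \<nu> \<eta> \<in> borel_measurable \<nu>"
    unfolding entropy_density_def by measurable
  \<comment> \<open>\<open>relative_entropy\<close> branches on integrability, so this has to agree
    on both sides as well as the value of the integral.\<close>
  have "integrable \<eta> (entropy_density (exp 1) \<nu> \<eta>) \<longleftrightarrow>
      integrable \<eta> (\<lambda>x. entropy_density (exp 1) ?B\<nu> N (\<Psi> x))"
    by (rule integrable_cong_AE) (use AE in \<open>measurable\<close>)
  also have "\<dots> \<longleftrightarrow> integrable (distr \<eta> B \<Psi>) (entropy_density (exp 1) ?B\<nu> N)"
    by (rule integrable_distr_eq[symmetric]) measurable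
  finally have int: "integrable \<eta> (entropy_density (exp 1) \<nu> \<eta>) \<longleftrightarrow>
      integrable N (entropy_density (exp 1) ?B\<nu> N)"
    unfolding distr .
  have "KL_divergence (exp 1) \<nu> \<eta> = (\<integral>x. entropy_density (exp 1) ?B\<nu> N (\<Psi> x) \<partial>\<eta>)"
    unfolding KL_divergence_def by (rule integral_cong_AE) (use AE in \<open>measurable\<close>)
  also have "\<dots> = integral\<^sup>L (distr \<eta> B \<Psi>) (entropy_density (exp 1) ?B\<nu> N)"
    by (rule integral_distr[symmetric]) measurable
  finally have "KL_divergence (exp 1) \<nu> \<eta> = KL_divergence (exp 1) ?B\<nu> N"
    unfolding distr KL_divergence_def .
  then show "relative_entropy \<eta> \<nu> = relative_entropy N ?B\<nu>"
    unfolding relative_entropy_def using int ac ac\<eta> by simp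
qed

text \<open>The set \<open>A\<close> carries \<open>\<mu>\<close>, and \<open>\<Psi>\<close> does
  not increase the cost on it. The left inverse \<open>\<rho>\<close> carries measurable majorants
  of the cost \<open>c\<close> to majorants of \<open>d\<close>; measurability of the image of
  \<open>A\<close> keeps them measurable after redefinition off that image.\<close>

lemma transport_ineq_distr:
  fixes E :: "'x topology" and F :: "'y topology"
  assumes ineq: "transport_ineq p E c \<alpha> \<mu>" and p: "p \<ge> 0" and \<alpha>: "\<alpha> > 0"
    and \<Psi>: "\<Psi> \<in> measurable (topo_borel E) (topo_borel F)"
    and \<rho>: "\<rho> \<in> measurable (topo_borel F) (topo_borel E)"
    and A: "AE x in \<mu>. x \<in> A" "A \<subseteq> topspace E"
    and \<Psi>A: "\<Psi> ` A \<in> sets (topo_borel F)"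
    and left_inv: "\<And>x. x \<in> A \<Longrightarrow> \<rho> (\<Psi> x) = x"
    and cost: "\<And>x y. x \<in> A \<Longrightarrow> y \<in> A \<Longrightarrow> d (\<Psi> x) (\<Psi> y) \<le> c x y"
  shows "transport_ineq p F d \<alpha> (distr \<mu> (topo_borel F) \<Psi>)"
proof -
  let ?F = "topo_borel F"
  let ?B = "distr \<mu> ?F \<Psi>"
  note [measurable] = \<Psi>A
  have \<mu>: "prob_space \<mu>" and sets_\<mu> [measurable_cong]: "sets \<mu> = sets (topo_borel E)"
    using ineq by (auto simp: transport_ineq_def)
  interpret \<mu>: prob_space \<mu> by fact
  have \<Psi>_\<mu> [measurable]: "\<Psi> \<in> measurable \<mu> ?F" using \<Psi> by (simp cong: measurable_cong_sets)
  have B: "prob_space ?B" by (rule \<mu>.prob_space_distr) fact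
  have main: "epowr (INF \<pi>\<in>couplings ?B N. upper_nn_integral \<pi> (\<lambda>(x, y). epowr (d x y) p)) (1 / p)
      \<le> epowr (ennreal (2 / \<alpha>) * relative_entropy N ?B) (1 / 2)"
    if N: "prob_space N" and sets_N [measurable_cong]: "sets N = sets ?F"
      and ac: "absolutely_continuous ?B N" for N
  proof -
    define \<eta> where "\<eta> = density \<mu> (\<lambda>x. RN_deriv ?B N (\<Psi> x))"
    note \<eta> = relative_entropy_density_comp[OF \<mu> N \<Psi>_\<mu> sets_N ac \<eta>_def]
    have [measurable]: "RN_deriv ?B N \<in> borel_measurable ?F"
      using borel_measurable_RN_deriv[of ?B N] by simp
    have sets_\<eta> [measurable_cong]: "sets \<eta> = sets (topo_borel E)"
      unfolding \<eta>_def using sets_\<mu> by simp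
    \<comment> \<open>The total mass of \<open>\<eta>\<close> is read off from its image
      \<open>N\<close>.\<close>
    have prob_\<eta>: "prob_space \<eta>"
      by (rule prob_space_distrD[where f = \<Psi> and N = ?F]) (use \<eta>(1) N in \<open>simp_all, measurable\<close>)
    have A\<eta>: "AE x in \<eta>. x \<in> A"
      by (rule absolutely_continuous_AE[OF _ _ A(1)])
        (simp_all add: \<eta>_def absolutely_continuousI_density)
    have INF_le: "(INF \<pi>\<in>couplings ?B N. upper_nn_integral \<pi> (\<lambda>(x, y). epowr (d x y) p))
        \<le> (INF \<pi>\<in>couplings \<mu> \<eta>. upper_nn_integral \<pi> (\<lambda>(x, y). epowr (c x y) p))"
    proof (rule INF_greatest)
      fix \<pi> assume \<pi>: "\<pi> \<in> couplings \<mu> \<eta>"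
      then have sets_\<pi>': "sets \<pi> = sets (\<mu> \<Otimes>\<^sub>M \<eta>)"
        and fst\<pi>: "distr \<pi> \<mu> fst = \<mu>" and snd\<pi>: "distr \<pi> \<eta> snd = \<eta>"
        by (auto simp: couplings_def)
      have sets_\<pi> [measurable_cong]: "sets \<pi> = sets (topo_borel E \<Otimes>\<^sub>M topo_borel E)"
        unfolding sets_\<pi>' by (intro sets_pair_measure_cong sets_\<mu> sets_\<eta>)
      define \<pi>' where "\<pi>' = distr \<pi> (?F \<Otimes>\<^sub>M ?F) (map_prod \<Psi> \<Psi>)"
      have sets_FF: "sets (?B \<Otimes>\<^sub>M N) = sets (?F \<Otimes>\<^sub>M ?F)"
        by (intro sets_pair_measure_cong) (simp_all add: sets_N)
      note [measurable] = \<Psi>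
      have map_meas [measurable]: "map_prod \<Psi> \<Psi> \<in> measurable \<pi> (?F \<Otimes>\<^sub>M ?F)"
        unfolding map_prod_def case_prod_beta by measurable
      \<comment> \<open>Coordinate projections commute with \<open>map_prod \<Psi> \<Psi>\<close>,
        so each marginal of \<open>\<pi>'\<close> is the image under \<open>\<Psi>\<close> of the
        corresponding marginal of \<open>\<pi>\<close>.\<close>
      have "distr \<pi>' ?B fst = distr \<pi> ?F (\<Psi> \<circ> fst)"
        unfolding \<pi>'_def by (subst distr_distr) (auto intro!: distr_cong)
      also have "\<dots> = distr (distr \<pi> \<mu> fst) ?F \<Psi>"
        by (subst distr_distr) (auto simp: sets_\<pi>' cong: measurable_cong_sets)
      finally have 1: "distr \<pi>' ?B fst = ?B" unfolding fst\<pi> .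
      have "distr \<pi>' N snd = distr \<pi> ?F (\<Psi> \<circ> snd)"
        unfolding \<pi>'_def
        by (subst distr_distr) (auto intro!: distr_cong simp: sets_N cong: measurable_cong_sets)
      also have "\<dots> = distr (distr \<pi> \<eta> snd) ?F \<Psi>"
        by (subst distr_distr) (auto simp: sets_\<pi>' cong: measurable_cong_sets)
      finally have 2: "distr \<pi>' N snd = N" unfolding snd\<pi> \<eta>(1) .
      have \<pi>'_in: "\<pi>' \<in> couplings ?B N"
        unfolding couplings_def using 1 2 sets_FF by (simp add: \<pi>'_def)
      \<comment> \<open>Both marginals give full mass to \<open>A\<close>, so \<open>\<pi>'\<close>
        is concentrated on pairs from the image of \<open>A\<close> and does not see how a majorant
        is extended elsewhere.\<close>
      have A\<pi>: "AE z in \<pi>. fst z \<in> A \<and> snd z \<in> A"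
      proof -
        have "AE z in \<pi>. fst z \<in> A"
          by (rule AE_distrD[of fst \<pi> \<mu>])
            (simp add: sets_\<pi>' cong: measurable_cong_sets, unfold fst\<pi>, fact A(1))
        moreover have "AE z in \<pi>. snd z \<in> A"
          by (rule AE_distrD[of snd \<pi> \<eta>])
            (simp add: sets_\<pi>' cong: measurable_cong_sets, unfold snd\<pi>, fact A\<eta>)
        ultimately show ?thesis by simp
      qed
      have "upper_nn_integral \<pi>' (\<lambda>(x, y). epowr (d x y) p)
          \<le> upper_nn_integral \<pi> (\<lambda>(x, y). epowr (c x y) p)"
        unfolding upper_nn_integral_def[of \<pi>]
      proof (rule Inf_greatest, clarify)
        fix g assume g [measurable]: "g \<in> borel_measurable \<pi>"
          and le: "\<forall>z\<in>space \<pi>. (case z of (x, y) \<Rightarrow> epowr (c x y) p) \<le> g z"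
        \<comment> \<open>The cost is only bounded on \<open>\<Psi> ` A\<close>, so the majorant is made infinite elsewhere.\<close>
        define g' where "g' z = (if fst z \<in> \<Psi> ` A \<and> snd z \<in> \<Psi> ` A
            then g (\<rho> (fst z), \<rho> (snd z)) else top)" for z
        have [measurable]: "g \<in> borel_measurable (topo_borel E \<Otimes>\<^sub>M topo_borel E)"
          using g by (simp cong: measurable_cong_sets add: sets_\<pi>)
        note [measurable] = \<rho>
        have g' [measurable]: "g' \<in> borel_measurable (?F \<Otimes>\<^sub>M ?F)"
          unfolding g'_def by measurable
        have bound: "epowr (d x y) p \<le> g' (x, y)" for x y
        proof (cases "x \<in> \<Psi> ` A \<and> y \<in> \<Psi> ` A")
          case True
          then obtain a b where ab: "a \<in> A" "b \<in> A" "x = \<Psi> a" "y = \<Psi> b" by blast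
          have ab_space: "(a, b) \<in> space \<pi>"
            using ab A(2) by (simp add: sets_eq_imp_space_eq[OF sets_\<pi>] space_pair_measure subset_iff)
          have "epowr (c a b) p \<le> g (a, b)" using bspec[OF le ab_space] by simp
          moreover have "epowr (d x y) p \<le> epowr (c a b) p"
            using cost ab p by (simp add: epowr_mono)
          ultimately show ?thesis using ab by (auto simp: g'_def left_inv)
        next
          case False
          then show ?thesis by (auto simp: g'_def)
        qed
        have "upper_nn_integral \<pi>' (\<lambda>(x, y). epowr (d x y) p) \<le> (\<integral>\<^sup>+ z. g' z \<partial>\<pi>')"
          unfolding upper_nn_integral_def
        proof (rule Inf_lower, rule CollectI, intro exI conjI)
          show "g' \<in> borel_measurable \<pi>'" unfolding \<pi>'_def by simp
        qed (use bound in auto)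
        also have "\<dots> = (\<integral>\<^sup>+ z. g' (map_prod \<Psi> \<Psi> z) \<partial>\<pi>)"
          unfolding \<pi>'_def by (rule nn_integral_distr) measurable
        also have "\<dots> = (\<integral>\<^sup>+ z. g z \<partial>\<pi>)"
        proof (rule nn_integral_cong_AE)
          show "AE z in \<pi>. g' (map_prod \<Psi> \<Psi> z) = g z"
            using A\<pi> by eventually_elim (auto simp: g'_def left_inv)
        qed
        finally show "upper_nn_integral \<pi>' (\<lambda>(x, y). epowr (d x y) p) \<le> (\<integral>\<^sup>+ z. g z \<partial>\<pi>)" .
      qed
      then show "(INF \<pi>\<in>couplings ?B N. upper_nn_integral \<pi> (\<lambda>(x, y). epowr (d x y) p))
          \<le> upper_nn_integral \<pi> (\<lambda>(x, y). epowr (c x y) p)"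
        by (rule INF_lower2[OF \<pi>'_in])
    qed
    have "epowr (INF \<pi>\<in>couplings ?B N. upper_nn_integral \<pi> (\<lambda>(x, y). epowr (d x y) p)) (1 / p)
        \<le> epowr (INF \<pi>\<in>couplings \<mu> \<eta>. upper_nn_integral \<pi> (\<lambda>(x, y). epowr (c x y) p)) (1 / p)"
      using p by (intro epowr_mono INF_le) simp
    also have "\<dots> \<le> epowr (ennreal (2 / \<alpha>) * relative_entropy \<eta> \<mu>) (1 / 2)"
      using ineq prob_\<eta> sets_\<eta> by (simp add: transport_ineq_def)
    finally show ?thesis unfolding \<eta>(2) .
  qed
  show ?thesis
    unfolding transport_ineq_def
  proof (intro conjI allI impI)
    fix N assume "prob_space N \<and> sets N = sets ?F"
    then have N: "prob_space N" "sets N = sets ?F" by auto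
    show "epowr (INF \<pi>\<in>couplings ?B N. upper_nn_integral \<pi> (\<lambda>(x, y). epowr (d x y) p)) (1 / p)
      \<le> epowr (ennreal (2 / \<alpha>) * relative_entropy N ?B) (1 / 2)"
    proof (cases "absolutely_continuous ?B N")
      case True
      then show ?thesis by (rule main[OF N])
    next
      case False
      \<comment> \<open>The entropy is infinite here, and \<open>\<alpha> > 0\<close> keeps the
        factor in front of it nonzero.\<close>
      then have "ennreal (2 / \<alpha>) * relative_entropy N ?B = top"
        using \<alpha> by (simp add: relative_entropy_def ennreal_mult_top)
      then show ?thesis by (simp add: epowr_def)
    qed
  qed (use B in simp_all)
qed

section \<open>Coordinates of rough paths\<close>

lemma horizontal_curveD:
  assumes "horizontal_curve br u \<gamma>"
  shows "u absolutely_integrable_on {0..1}"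
    and "t \<in> {0..1} \<Longrightarrow> fst (\<gamma> t) = fst (\<gamma> 0) + integral {0..t} u"
    and "t \<in> {0..1} \<Longrightarrow> snd (\<gamma> t) = snd (\<gamma> 0) +
      integral {0..t} (\<lambda>s. (1 / 2) *\<^sub>R br (fst (\<gamma> s)) (u s))"
  using assms unfolding horizontal_curve_def by blast+

text \<open>The first component of a horizontal curve has velocity \<open>u\<close>, so its
  displacement is at most the length of the curve.\<close>

lemma norm_fst_le_cc_dist: "ennreal (norm (fst g - fst h)) \<le> cc_dist br g h"
  unfolding cc_dist_def
proof (rule Inf_greatest)
  fix l assume "l \<in> {ennreal (integral {0..1} (\<lambda>t. norm (u t))) | u \<gamma>.
    horizontal_curve br u \<gamma> \<and> \<gamma> 0 = g \<and> \<gamma> 1 = h}"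
  then obtain u \<gamma> where \<gamma>: "horizontal_curve br u \<gamma>" "\<gamma> 0 = g" "\<gamma> 1 = h"
    and l: "l = ennreal (integral {0..1} (\<lambda>t. norm (u t)))" by blast
  have u: "u absolutely_integrable_on {0..1}" using \<gamma>(1) by (rule horizontal_curveD)
  have "fst h - fst g = integral {0..1} u"
    using horizontal_curveD(2)[OF \<gamma>(1), of 1] \<gamma>(2,3) by simp
  with u have "norm (fst h - fst g) \<le> integral {0..1} (\<lambda>t. norm (u t))"
    by (auto simp: absolutely_integrable_on_def intro!: integral_norm_bound_integral)
  then show "ennreal (norm (fst g - fst h)) \<le> l"
    by (simp add: l norm_minus_commute ennreal_leI)
qed

text \<open>Along a curve of length below \<open>r\<close> the first component stays within
  \<open>r\<close> of \<open>fst g\<close>, which bounds the velocity of the second component by a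
  multiple of \<open>norm (u s)\<close>. The bound vanishes with \<open>r\<close>, so small balls of
  the Carnot-Caratheodory distance are small in the Euclidean norm.\<close>

lemma norm_snd_le_of_cc_dist_less:
  assumes B: "\<And>x y. norm (br x y) \<le> B * norm x * norm y" "B > 0"
    and less: "cc_dist br g h < ennreal r" and r: "r > 0"
  shows "norm (snd h - snd g) \<le> B * (norm (fst g) + r) * r"
proof -
  \<comment> \<open>A strict inequality for an infimum supplies an actual curve from
    \<open>g\<close> to \<open>h\<close> of length below \<open>r\<close>.\<close>
  obtain u \<gamma> where \<gamma>: "horizontal_curve br u \<gamma>" "\<gamma> 0 = g" "\<gamma> 1 = h"
    and len: "ennreal (integral {0..1} (\<lambda>t. norm (u t))) < ennreal r"
    using less unfolding cc_dist_def Inf_less_iff by blast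
  let ?L = "integral {0..1} (\<lambda>t. norm (u t))"
  have u: "u integrable_on {0..1}" "(\<lambda>t. norm (u t)) integrable_on {0..1}"
    using horizontal_curveD(1)[OF \<gamma>(1)] by (auto simp: absolutely_integrable_on_def)
  have L: "?L < r" "0 \<le> ?L"
    using len r by (auto simp: ennreal_less_iff integral_nonneg u)
  have fst_bound: "norm (fst (\<gamma> t)) \<le> norm (fst g) + r" if t: "t \<in> {0..1}" for t
  proof -
    have ut: "u integrable_on {0..t}" "(\<lambda>t. norm (u t)) integrable_on {0..t}"
      using t by (auto intro: integrable_on_subinterval[OF u(1)] integrable_on_subinterval[OF u(2)])
    have "norm (integral {0..t} u) \<le> integral {0..t} (\<lambda>t. norm (u t))"
      using ut by (intro integral_norm_bound_integral) auto
    also have "\<dots> \<le> ?L"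
      using t by (intro integral_subset_le ut u) auto
    finally have "norm (integral {0..t} u) \<le> r" using L by simp
    moreover have "fst (\<gamma> t) = fst g + integral {0..t} u"
      using horizontal_curveD(2)[OF \<gamma>(1) t] \<gamma>(2) by simp
    ultimately show ?thesis using norm_triangle_ineq[of "fst g" "integral {0..t} u"] by simp
  qed
  let ?f = "\<lambda>s. (1 / 2) *\<^sub>R br (fst (\<gamma> s)) (u s)"
  have pos: "0 \<le> B * (norm (fst g) + r)" using B(2) r by simp
  have "snd h - snd g = integral {0..1} ?f"
    using horizontal_curveD(3)[OF \<gamma>(1), of 1] \<gamma>(2,3) by simp
  moreover have "norm (integral {0..1} ?f) \<le> B * (norm (fst g) + r) * ?L"
  \<comment> \<open>\<open>horizontal_curve\<close> does not state that this integrand is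
    integrable; if it were not, \<open>integral\<close> would be 0 and the bound trivial.\<close>
  proof (cases "?f integrable_on {0..1}")
    case True
    have "norm (integral {0..1} ?f) \<le> integral {0..1} (\<lambda>s. B * (norm (fst g) + r) * norm (u s))"
    proof (rule integral_norm_bound_integral[OF True])
      show "(\<lambda>s. B * (norm (fst g) + r) * norm (u s)) integrable_on {0..1}"
        using u(2) by (rule integrable_on_mult_right)
      fix s :: real assume s: "s \<in> {0..1}"
      have "norm (?f s) \<le> norm (br (fst (\<gamma> s)) (u s))" by simp
      also have "\<dots> \<le> B * norm (fst (\<gamma> s)) * norm (u s)" by (rule B)
      also have "\<dots> \<le> B * (norm (fst g) + r) * norm (u s)"
        using fst_bound[OF s] B(2) by (intro mult_right_mono mult_left_mono) auto
      finally show "norm (?f s) \<le> B * (norm (fst g) + r) * norm (u s)" .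
    qed
    then show ?thesis by simp
  next
    case False
    then show ?thesis using pos L by (simp add: not_integrable_integral)
  qed
  moreover have "B * (norm (fst g) + r) * ?L \<le> B * (norm (fst g) + r) * r"
    using L pos by (intro mult_left_mono) auto
  ultimately show ?thesis by simp
qed

text \<open>The interval from 0 to \<open>t\<close> is one of those over which the supremum runs. In
  the Hoelder case the denominator \<open>t powr \<beta>\<close> is at most 1, so dividing by it
  only enlarges \<open>F 0 t\<close>.\<close>

lemma le_variation:
  assumes ty: "level2_type ty" and t: "0 < t" "t \<le> 1"
  shows "F 0 t \<le> variation ty F"
proof (cases ty)
  case (PVar p)
  then have p: "1 \<le> p" using ty by simp
  \<comment> \<open>The dissection 0, \<open>t\<close>, 1; for \<open>t = 1\<close> its last
    interval degenerates, which \<open>dissections\<close> permits.\<close>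
  define \<tau> :: "nat \<Rightarrow> real" where "\<tau> i = (if i = 0 then 0 else if i = 1 then t else 1)" for i
  have \<tau>: "(2, \<tau>) \<in> dissections" using t by (auto simp: dissections_def \<tau>_def)
  have "epowr (F 0 t) p \<le> (\<Sum>i<2. epowr (F (\<tau> i) (\<tau> (Suc i))) p)"
    by (simp add: \<tau>_def numeral_2_eq_2)
  also have "\<dots> \<le> (SUP (n, t)\<in>dissections. \<Sum>i<n. epowr (F (t i) (t (Suc i))) p)"
    using SUP_upper[OF \<tau>, of "\<lambda>(n, t). \<Sum>i<n. epowr (F (t i) (t (Suc i))) p"] by simp
  finally have "epowr (epowr (F 0 t) p) (1 / p) \<le> variation ty F"
    using p by (simp add: PVar epowr_mono)
  moreover have "epowr (epowr (F 0 t) p) (1 / p) = F 0 t"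
    using p by (cases "F 0 t") (auto simp: epowr_def powr_powr)
  ultimately show ?thesis by simp
next
  case (Hoelder \<beta>)
  then have "\<beta> > 0" using ty by simp
  then have c: "0 < t powr \<beta>" "t powr \<beta> \<le> 1" using t by (auto intro: powr_le1)
  then have "1 \<le> inverse (ennreal (t powr \<beta>))"
    by (simp add: inverse_ennreal one_le_inverse flip: ennreal_1)
  then have "F 0 t \<le> F 0 t / ennreal (t powr \<beta>)"
    unfolding divide_ennreal_def using mult_left_mono[of 1 _ "F 0 t"] by fastforce
  also have "\<dots> \<le> variation ty F"
    using SUP_upper[of "(0, t)" "{(s, t). 0 \<le> s \<and> s < t \<and> t \<le> 1}"
        "\<lambda>(s, t). F s t / ennreal ((t - s) powr \<beta>)"] t
    by (simp add: Hoelder)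
  finally show ?thesis .
qed

text \<open>Rough paths start at the identity, so the increment from 0 to \<open>t\<close> is the
  value at \<open>t\<close>.\<close>

lemma cc_dist_le_rough_dist:
  assumes "carnot_bracket br" "level2_type ty" "0 < t" "t \<le> 1"
    and "X \<in> rough_paths br ty" "Y \<in> rough_paths br ty"
  shows "cc_dist br (X t) (Y t) \<le> rough_dist br ty X Y"
  using le_variation[OF assms(2-4),
      of "\<lambda>s t. cc_dist br (path_increment br X s t) (path_increment br Y s t)"] assms(5,6)
  by (simp add: rough_dist_def path_increment_def rough_paths_def carnot_mult_zero[OF assms(1)])

section \<open>Measurability of evaluations, of the projection and of the image of the lift\<close>

lemma topspace_rough_topology [simp]: "topspace (rough_topology br ty) = rough_paths br ty"
  unfolding rough_topology_def by simp

lemma topspace_path_topology [simp]: "topspace path_topology = path_space"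
  unfolding path_topology_def by simp

text \<open>Evaluation at \<open>t\<close> is continuous into the Euclidean topology: the rough
  distance dominates the Carnot-Caratheodory distance at time \<open>t\<close>, which controls both
  layers locally.\<close>

lemma measurable_rough_coordinate:
  fixes br :: "'a::euclidean_space \<Rightarrow> 'a \<Rightarrow> 'b::euclidean_space"
  assumes br: "carnot_bracket br" and ty: "level2_type ty" and t: "0 < t" "t \<le> 1"
  shows "(\<lambda>X. X t) \<in> borel_measurable (topo_borel (rough_topology br ty))"
proof (rule borel_measurableI)
  fix U :: "('a \<times> 'b) set" assume U: "open U"
  let ?D = "rough_paths br ty"
  obtain B where B: "B > 0" "\<And>x y. norm (br x y) \<le> B * norm x * norm y"
    using br bilinear_bounded_pos unfolding carnot_bracket_def by blast
  have "openin (rough_topology br ty) {X \<in> ?D. X t \<in> U}"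
    unfolding rough_topology_def openin_edist_topology
  proof (intro conjI ballI)
    fix X assume X: "X \<in> {X \<in> ?D. X t \<in> U}"
    then obtain e where e: "e > 0" "ball (X t) e \<subseteq> U" using U open_contains_ball by blast
    \<comment> \<open>With \<open>r \<le> 1\<close> the first layer moves by at most
      \<open>r\<close> and the second by at most \<open>B * (norm (fst (X t)) + 1) * r\<close>. The
      sum is \<open>r * C\<close>, and \<open>r\<close> is chosen to make it at most
      \<open>e / 2\<close>.\<close>
    define C where "C = 1 + B * (norm (fst (X t)) + 1)"
    define r where "r = min 1 (e / (2 * C))"
    have C: "C > 0" unfolding C_def using B(1) by (intro add_pos_nonneg) auto
    then have r: "0 < r" "r \<le> 1" "r * C \<le> e / 2"
      using e(1) by (auto simp: r_def min_def field_simps)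
    have "Y t \<in> U" if Y: "Y \<in> ?D" "rough_dist br ty X Y < ennreal r" for Y
    proof -
      have less: "cc_dist br (X t) (Y t) < ennreal r"
        using cc_dist_le_rough_dist[OF br ty t _ Y(1)] X Y(2) by fastforce
      have 1: "norm (fst (Y t) - fst (X t)) \<le> r"
        using le_less_trans[OF norm_fst_le_cc_dist less] r(1)
        by (simp add: ennreal_less_iff norm_minus_commute)
      have "norm (snd (Y t) - snd (X t)) \<le> B * (norm (fst (X t)) + r) * r"
        by (rule norm_snd_le_of_cc_dist_less[OF B(2,1) less r(1)])
      also have "\<dots> \<le> B * (norm (fst (X t)) + 1) * r"
        using B(1) r by (intro mult_right_mono mult_left_mono) auto
      finally have 2: "norm (snd (Y t) - snd (X t)) \<le> B * (norm (fst (X t)) + 1) * r" .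
      have "norm (Y t - X t) \<le> norm (fst (Y t) - fst (X t)) + norm (snd (Y t) - snd (X t))"
        by (metis fst_diff snd_diff norm_Pair_le prod.collapse)
      with 1 2 have "norm (Y t - X t) \<le> r * C"
        by (simp add: C_def algebra_simps)
      then have "Y t \<in> ball (X t) e"
        using r(3) e(1) by (simp add: dist_norm norm_minus_commute)
      then show ?thesis using e(2) by blast
    qed
    then show "\<exists>r>0. \<forall>Y\<in>?D. rough_dist br ty X Y < r \<longrightarrow> Y \<in> {X \<in> ?D. X t \<in> U}"
      using r(1) by (intro exI[of _ "ennreal r"]) auto
  qed auto
  then show "(\<lambda>X. X t) -` U \<inter> space (topo_borel (rough_topology br ty))
      \<in> sets (topo_borel (rough_topology br ty))"
    by (auto dest!: openin_topo_borel simp: vimage_def Int_def conj_commute)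
qed

text \<open>The projection is 1-Lipschitz from the rough distance to the uniform distance, hence
  continuous.\<close>

lemma measurable_proj1:
  fixes br :: "'a::euclidean_space \<Rightarrow> 'a \<Rightarrow> 'b::euclidean_space"
  assumes br: "carnot_bracket br" and ty: "level2_type ty"
  shows "proj1 \<in> measurable (topo_borel (rough_topology br ty)) (topo_borel path_topology)"
proof (rule measurable_topo_borelI)
  let ?D = "rough_paths br ty"
  have maps: "proj1 X \<in> path_space" if "X \<in> ?D" for X
    using that by (auto simp: rough_paths_def path_space_def proj1_def intro!: continuous_intros)
  then show "proj1 \<in> space (topo_borel (rough_topology br ty)) \<rightarrow> topspace path_topology" by auto
  fix U :: "(real \<Rightarrow> 'a) set" assume U: "openin path_topology U"
  have le: "(SUP t\<in>{0..1}. ennreal (norm (proj1 X t - proj1 Y t))) \<le> rough_dist br ty X Y"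
    if X: "X \<in> ?D" and Y: "Y \<in> ?D" for X Y
  proof (rule SUP_least)
    fix t :: real assume t: "t \<in> {0..1}"
    show "ennreal (norm (proj1 X t - proj1 Y t)) \<le> rough_dist br ty X Y"
    \<comment> \<open>At time 0 both paths vanish; the comparison with the rough distance covers
      positive times.\<close>
    proof (cases "t = 0")
      case True
      then show ?thesis using X Y by (simp add: proj1_def rough_paths_def)
    next
      case False
      then have "cc_dist br (X t) (Y t) \<le> rough_dist br ty X Y"
        using t by (intro cc_dist_le_rough_dist br ty X Y) auto
      with norm_fst_le_cc_dist show ?thesis unfolding proj1_def by (rule order_trans)
    qed
  qed
  have "openin (rough_topology br ty) (proj1 -` U \<inter> ?D)"
    unfolding rough_topology_def openin_edist_topology
  proof (intro conjI ballI)
    fix X assume X: "X \<in> proj1 -` U \<inter> ?D"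
    then obtain r where r: "r > 0"
      "\<forall>y\<in>path_space. (SUP t\<in>{0..1}. ennreal (norm (proj1 X t - y t))) < r \<longrightarrow> y \<in> U"
      using U unfolding path_topology_def openin_edist_topology by blast
    have "proj1 Y \<in> U" if "Y \<in> ?D" "rough_dist br ty X Y < r" for Y
      using r(2) maps[OF that(1)] le_less_trans[OF le that(2)] X that(1) by blast
    with r(1) show "\<exists>r>0. \<forall>Y\<in>?D. rough_dist br ty X Y < r \<longrightarrow> Y \<in> proj1 -` U \<inter> ?D"
      by blast
  qed auto
  then show "proj1 -` U \<inter> space (topo_borel (rough_topology br ty))
      \<in> sets (topo_borel (rough_topology br ty))"
    by (auto dest: openin_topo_borel)
qed

text \<open>By continuity the rationals of the open interval determine a path on
  \<open>{0..1}\<close>, endpoints included; outside, all paths vanish.\<close>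

lemma rough_paths_eqI:
  assumes X: "X \<in> rough_paths br ty" and Y: "Y \<in> rough_paths br ty"
    and eq: "\<And>t. t \<in> {0<..<1} \<inter> \<rat> \<Longrightarrow> X t = Y t"
  shows "X = Y"
proof
  fix t :: real
  show "X t = Y t"
  proof (cases "t \<in> {0..1}")
    case True
    have cl: "closure ({0<..<1} \<inter> \<rat>) = {0..1::real}"
      by (subst closure_open_Int_superset) (simp_all add: Rats_closure_real)
    have "X t - Y t = 0"
    proof (rule continuous_constant_on_closure[where S = "{0<..<1} \<inter> \<rat>" and f = "\<lambda>t. X t - Y t"])
      show "continuous_on (closure ({0<..<1} \<inter> \<rat>)) (\<lambda>t. X t - Y t)"
        unfolding cl using X Y by (auto simp: rough_paths_def intro!: continuous_intros)
    qed (use eq cl True in auto)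
    then show ?thesis by simp
  next
    case False
    then show ?thesis using X Y by (simp add: rough_paths_def)
  qed
qed

text \<open>The rough path space is not separable, so the diagonal need not be measurable for the product
  of its Borel sets; equality is therefore tested on countably many coordinates.\<close>

lemma lift_image_measurable:
  fixes br :: "'a::euclidean_space \<Rightarrow> 'a \<Rightarrow> 'b::euclidean_space"
  assumes br: "carnot_bracket br" and ty: "level2_type ty"
    and \<Psi>: "\<Psi> \<in> measurable (topo_borel path_topology) (topo_borel (rough_topology br ty))"
    and A [measurable]: "A \<in> sets (topo_borel path_topology)"
    and lift: "\<And>x. x \<in> A \<Longrightarrow> proj1 (\<Psi> x) = x"
  shows "\<Psi> ` A \<in> sets (topo_borel (rough_topology br ty))"
proof -
  let ?D = "topo_borel (rough_topology br ty)"
  let ?Q = "{0<..<1} \<inter> \<rat> :: real set"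
  note [measurable] = \<Psi> measurable_proj1[OF br ty]
  have A_sub: "A \<subseteq> path_space" using sets.sets_into_space[OF A] by simp
  have maps: "\<Psi> x \<in> rough_paths br ty" if "x \<in> path_space" for x
    using measurable_space[OF \<Psi>] that by simp
  have maps1: "proj1 X \<in> path_space" if "X \<in> rough_paths br ty" for X
    using measurable_space[OF measurable_proj1[OF br ty]] that by simp
  \<comment> \<open>As \<open>proj1\<close> inverts \<open>\<Psi>\<close> on \<open>A\<close>, the
    image consists of the fixed points \<open>X\<close> of \<open>\<Psi> \<circ> proj1\<close> with
    \<open>proj1 X \<in> A\<close>.\<close>
  have "\<Psi> ` A = {X \<in> space ?D. proj1 X \<in> A \<and> (\<forall>q\<in>?Q. \<Psi> (proj1 X) q = X q)}"
  proof (intro equalityI subsetI)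
    fix X assume X: "X \<in> {X \<in> space ?D. proj1 X \<in> A \<and> (\<forall>q\<in>?Q. \<Psi> (proj1 X) q = X q)}"
    then have "\<Psi> (proj1 X) = X"
      using maps maps1 by (intro rough_paths_eqI[of _ br ty]) auto
    then show "X \<in> \<Psi> ` A" using X by (auto intro!: image_eqI[of _ _ "proj1 X"])
  qed (use A_sub maps lift in auto)
  also have "\<dots> \<in> sets ?D"
  proof -
    have "{X \<in> space ?D. \<forall>q\<in>?Q. \<Psi> (proj1 X) q = X q} \<in> sets ?D"
    proof (rule sets.sets_Collect_countable_All')
      fix q assume "q \<in> ?Q"
      then have [measurable]: "(\<lambda>X. X q) \<in> borel_measurable ?D"
        by (intro measurable_rough_coordinate br ty) auto
      have [measurable]: "(\<lambda>X. \<Psi> (proj1 X) q) \<in> borel_measurable ?D"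
        by (rule measurable_compose[where g = "\<lambda>X. X q"]) measurable
      show "{X \<in> space ?D. \<Psi> (proj1 X) q = X q} \<in> sets ?D" by measurable
    qed (auto intro: countable_Int2 countable_rat)
    then have [measurable]: "Measurable.pred ?D (\<lambda>X. \<forall>q\<in>?Q. \<Psi> (proj1 X) q = X q)"
      by (simp add: pred_def)
    show ?thesis by measurable
  qed
  finally show ?thesis .
qed

section \<open>Symmetry of the Cameron--Martin norm\<close>

text \<open>Negating the coefficients of an approximating linear combination leaves the squared
  error unchanged.\<close>

lemma first_chaos_uminus:
  fixes \<mu> :: "(real \<Rightarrow> 'a::euclidean_space) measure"
  assumes "\<xi> \<in> first_chaos \<mu>"
  shows "(\<lambda>x. - \<xi> x) \<in> first_chaos \<mu>"
proof -
  have "\<exists>n (t :: nat \<Rightarrow> real) a. (\<forall>i<n. t i \<in> {0..1}) \<and>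
      (\<integral>x. (- \<xi> x - (\<Sum>i<n. a i \<bullet> centred \<mu> (t i) x))\<^sup>2 \<partial>\<mu>) < \<epsilon>" if "\<epsilon> > 0" for \<epsilon>
  proof -
    obtain n and t :: "nat \<Rightarrow> real" and a :: "nat \<Rightarrow> 'a" where *: "\<forall>i<n. t i \<in> {0..1}"
      "(\<integral>x. (\<xi> x - (\<Sum>i<n. a i \<bullet> centred \<mu> (t i) x))\<^sup>2 \<partial>\<mu>) < \<epsilon>"
      using assms \<open>\<epsilon> > 0\<close> unfolding first_chaos_def by blast
    have "(- \<xi> x - (\<Sum>i<n. - a i \<bullet> centred \<mu> (t i) x))\<^sup>2
        = (\<xi> x - (\<Sum>i<n. a i \<bullet> centred \<mu> (t i) x))\<^sup>2" for x
      unfolding power2_eq_square by (simp add: sum_negf algebra_simps)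
    with * show ?thesis
      by (intro exI[of _ n] exI[of _ t] exI[of _ "\<lambda>i. - a i"]) simp
  qed
  with assms show ?thesis unfolding first_chaos_def by simp
qed

lemma cm_represents_uminus:
  "cm_represents \<mu> \<xi> h \<Longrightarrow> cm_represents \<mu> (\<lambda>x. - \<xi> x) (\<lambda>t. - h t)"
  unfolding cm_represents_def by (simp add: first_chaos_uminus)

lemma cm_space_uminus: "h \<in> cm_space \<mu> \<Longrightarrow> (\<lambda>t. - h t) \<in> cm_space \<mu>"
  unfolding cm_space_def path_space_def
  by (auto intro!: continuous_intros dest: cm_represents_uminus)

text \<open>Negating representers shows that \<open>h\<close> and its negative admit the same values
  \<open>r\<close>, so the two definite descriptions have equivalent predicates and agree.\<close>

lemma cm_norm_uminus: "cm_norm \<mu> (\<lambda>t. - h t) = cm_norm \<mu> h"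
proof -
  have *: "\<exists>\<xi>. cm_represents \<mu> \<xi> (\<lambda>t. - g t) \<and> r = sqrt (\<integral>x. (\<xi> x)\<^sup>2 \<partial>\<mu>)"
    if ex: "\<exists>\<xi>. cm_represents \<mu> \<xi> g \<and> r = sqrt (\<integral>x. (\<xi> x)\<^sup>2 \<partial>\<mu>)" for g r
  proof -
    obtain \<xi> where "cm_represents \<mu> \<xi> g" "r = sqrt (\<integral>x. (\<xi> x)\<^sup>2 \<partial>\<mu>)"
      using ex by blast
    then show ?thesis
      by (intro exI[of _ "\<lambda>x. - \<xi> x"]) (simp add: cm_represents_uminus)
  qed
  show ?thesis
    unfolding cm_norm_def using *[of h] *[of "\<lambda>t. - h t"]
    by (intro arg_cong[of _ _ The] ext iffI) simp_all
qed

text \<open>The shift by \<open>y - x\<close> takes the lift of \<open>x\<close> to that of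
  \<open>y\<close>, so its norm competes in the infimum. \<open>cm_cost\<close> is written with
  \<open>x - y\<close>, whence the appeal to symmetry of the norm.\<close>

lemma shift_cost_le_cm_cost:
  assumes "\<And>h. h \<in> cm_space \<mu> \<Longrightarrow> T h (\<Psi> x) = \<Psi> (\<lambda>t. x t + h t)"
  shows "shift_cost \<mu> T (\<Psi> x) (\<Psi> y) \<le> cm_cost \<mu> x y"
proof (cases "(\<lambda>t. x t - y t) \<in> cm_space \<mu>")
  case True
  let ?h = "\<lambda>t. y t - x t"
  have h: "?h \<in> cm_space \<mu>" using cm_space_uminus[OF True] by simp
  then have "\<Psi> y = T ?h (\<Psi> x)" using assms[OF h] by simp
  moreover have "cm_norm \<mu> (\<lambda>t. x t - y t) = cm_norm \<mu> ?h"
    using cm_norm_uminus[of \<mu> ?h] by simp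
  ultimately show ?thesis
    using h True by (auto simp: shift_cost_def cm_cost_def intro!: Inf_lower)
qed (simp add: cm_cost_def)

section \<open>Transfer of the Gaussian inequality to the law of the lift\<close>

theorem theorem4p4:
  fixes M :: "'w measure"
    and Z :: "'w \<Rightarrow> real \<Rightarrow> 'a::euclidean_space"
    and br :: "'a \<Rightarrow> 'a \<Rightarrow> 'b::euclidean_space"
    and ty :: rough_type
    and BZ :: "'w \<Rightarrow> real \<Rightarrow> 'a \<times> 'b"
    and \<nu> :: "(real \<Rightarrow> 'a) measure"
    and B\<nu> :: "(real \<Rightarrow> 'a \<times> 'b) measure"
    and \<Omega>' :: "(real \<Rightarrow> 'a) set"
    and \<Psi> :: "(real \<Rightarrow> 'a) \<Rightarrow> real \<Rightarrow> 'a \<times> 'b"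
    and T :: "(real \<Rightarrow> 'a) \<Rightarrow> (real \<Rightarrow> 'a \<times> 'b) \<Rightarrow> real \<Rightarrow> 'a \<times> 'b"
  assumes carnot: "carnot_bracket br"
    and type: "level2_type ty"
    and prob: "prob_space M"
    and Z_meas: "Z \<in> measurable M (topo_borel path_topology)"
    and Z_gauss: "gaussian_process M Z"
    and \<nu>: "\<nu> = distr M (topo_borel path_topology) Z"
    and BZ_meas: "\<forall>A\<in>sets (topo_borel (rough_topology br ty)). BZ -` A \<inter> space M \<in> sets M"
    and BZ_rough: "AE w in M. BZ w \<in> rough_paths br ty"
    and BZ_lift: "AE w in M. proj1 (BZ w) = Z w"
    and B\<nu>: "B\<nu> = distr M (topo_borel (rough_topology br ty)) BZ"
    and known_T2: "transport_ineq 2 path_topology (cm_cost \<nu>) 1 \<nu>"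
    and \<Omega>'_subset: "\<Omega>' \<subseteq> path_space"
    and \<Omega>'_full: "emeasure \<nu> \<Omega>' = 1"
    and \<Psi>_meas: "\<Psi> \<in> measurable (topo_borel path_topology) (topo_borel (rough_topology br ty))"
    and \<Psi>_lift: "\<forall>x\<in>\<Omega>'. proj1 (\<Psi> x) = x"
    and \<Psi>_Z: "AE w in M. \<Psi> (Z w) = BZ w"
    and T_cont: "continuous_map (prod_topology (cm_topology \<nu>) (rough_topology br ty))
                   (rough_topology br ty) (\<lambda>(h, X). T h X)"
    and T_shift: "\<forall>x\<in>\<Omega>'. \<forall>h\<in>cm_space \<nu>. T h (\<Psi> x) = \<Psi> (\<lambda>t. x t + h t)"
  shows "transport_ineq 2 (rough_topology br ty) (shift_cost \<nu> T) 1 B\<nu>"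
proof -
  let ?\<Omega> = "topo_borel (path_topology :: (real \<Rightarrow> 'a) topology)"
  let ?D = "topo_borel (rough_topology br ty)"
  interpret M: prob_space M by fact
  have sets_\<nu>: "sets \<nu> = sets ?\<Omega>" unfolding \<nu> by simp
  interpret \<nu>: prob_space \<nu> unfolding \<nu> by (rule M.prob_space_distr) fact
  \<comment> \<open>\<open>emeasure\<close> is 0 on non-measurable sets, so the value 1 forces
    measurability.\<close>
  have \<Omega>'_meas: "\<Omega>' \<in> sets ?\<Omega>"
    using \<Omega>'_full emeasure_notin_sets[of \<Omega>' \<nu>] sets_\<nu> by fastforce
  have \<Omega>'_AE: "AE x in \<nu>. x \<in> \<Omega>'"
    using \<Omega>'_full \<Omega>'_meas sets_\<nu> by (intro \<nu>.AE_prob_1) (simp add: measure_def)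
  \<comment> \<open>\<open>BZ\<close> may leave the rough path space on a null set. Replacing it by
    \<open>\<Psi> \<circ> Z\<close> gives a genuinely measurable map with the same law.\<close>
  have "B\<nu> = distr M ?D (\<lambda>w. \<Psi> (Z w))"
    unfolding B\<nu> using BZ_meas \<Psi>_Z
    by (intro distr_cong_AE_vimage measurable_compose[OF Z_meas \<Psi>_meas]) auto
  also have "\<dots> = distr \<nu> ?D \<Psi>"
    unfolding \<nu> by (simp add: distr_distr[OF \<Psi>_meas Z_meas] comp_def)
  finally have B\<nu>_eq: "B\<nu> = distr \<nu> ?D \<Psi>" .
  show ?thesis
    unfolding B\<nu>_eq
  \<comment> \<open>Here \<open>\<Omega>'\<close> is the carrying set and \<open>proj1\<close> the
    measurable left inverse of \<open>\<Psi>\<close> on it.\<close>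
  proof (rule transport_ineq_distr[OF known_T2 _ _ \<Psi>_meas measurable_proj1[OF carnot type] \<Omega>'_AE])
    show "\<Psi> ` \<Omega>' \<in> sets ?D"
      using \<Psi>_lift by (intro lift_image_measurable carnot type \<Psi>_meas \<Omega>'_meas) auto
    show "shift_cost \<nu> T (\<Psi> x) (\<Psi> y) \<le> cm_cost \<nu> x y" if "x \<in> \<Omega>'" for x y
      using T_shift that by (intro shift_cost_le_cm_cost) auto
  qed (use \<Omega>'_subset \<Psi>_lift in auto)
qed

end
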